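(* Let $(A,\mu,\Delta,\alpha)$ be an $\epsilon$-Hom-bialgebra. Then for each integer $n\ge 0$ the quadruple $$A^n=(A,\mu^{(n)},\Delta^{(n)},\alpha^{2^n})$$ is also an $\epsilon$-Hom-bialgebra, where $\mu^{(n)}=\alpha^{2^n-1}\circ\mu$ and $\Delta^{(n)}=\Delta\circ\alpha^{2^n-1}$.
   Context: Throughout, $\mathbf{k}$ is a fixed field of characteristic $0$; vector spaces, linear maps and tensor products are over $\mathbf{k}$. For a linear self-map $f$, $f^m$ denotes its $m$-fold composition, with $f^0=Id$. A Hom-associative algebra $(A,\mu,\alpha)$ is a $\mathbf{k}$-vector space $A$ with a bilinear map $\mu\colon A^{\otimes 2}\to A$ and a linear map $\alpha\colon A\to A$ such that $\alpha\circ\mu=\mu\circ\alpha^{\otimes 2}$ and $\mu\circ(\alpha\otimes\mu)=\mu\circ(\mu\otimes\alpha)$. A Hom-coassociative coalgebra $(A,\Delta,\alpha)$ is a $\mathbf{k}$-vector space $A$ with linear maps $\Delta\colon A\to A^{\otimes 2}$ and $\alpha\colon A\to A$ such that $\alpha^{\otimes 2}\circ\Delta=\Delta\circ\alpha$ and $(\alpha\otimes\Delta)\circ\Delta=(\Delta\otimes\alpha)\circ\Delta$. An $\epsilon$-Hom-bialgebra (infinitesimal Hom-bialgebra) is a quadruple $(A,\mu,\Delta,\alpha)$ such that $(A,\mu,\alpha)$ is a Hom-associative algebra, $(A,\Delta,\alpha)$ is a Hom-coassociative coalgebra, and $$\Delta\circ\mu=(\mu\otimes\alpha)\circ(\alpha\otimes\Delta)+(\alpha\otimes\mu)\circ(\Delta\otimes\alpha).$$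 *)

theory Defs
  imports "HOL-Algebra.Module" "HOL-Algebra.Free_Abelian_Groups"
begin

section \<open>Linear and bilinear maps\<close>

definition lin_hom ::
  "('r, 'm) ring_scheme \<Rightarrow> ('r, 'a, 'n) module_scheme \<Rightarrow> ('r, 'b, 'p) module_scheme \<Rightarrow> ('a \<Rightarrow> 'b) set"
  where "lin_hom R V W =
    {f \<in> carrier V \<rightarrow> carrier W.
       (\<forall>x\<in>carrier V. \<forall>y\<in>carrier V. f (x \<oplus>\<^bsub>V\<^esub> y) = f x \<oplus>\<^bsub>W\<^esub> f y) \<and>
       (\<forall>c\<in>carrier R. \<forall>x\<in>carrier V. f (c \<odot>\<^bsub>V\<^esub> x) = c \<odot>\<^bsub>W\<^esub> f x)}"

definition bilin_hom ::
  "('r, 'm) ring_scheme \<Rightarrow> ('r, 'a, 'n) module_scheme \<Rightarrow> ('r, 'b, 'p) module_scheme \<Rightarrow>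
   ('r, 'c, 'q) module_scheme \<Rightarrow> ('a \<Rightarrow> 'b \<Rightarrow> 'c) set"
  where "bilin_hom R V W P =
    {b. (\<forall>x\<in>carrier V. b x \<in> lin_hom R W P) \<and>
        (\<forall>y\<in>carrier W. (\<lambda>x. b x y) \<in> lin_hom R V P)}"

section \<open>The tensor product\<close>

text \<open>\<open>V \<otimes>\<^sub>R W\<close> is the free Abelian group on \<open>V \<times> W\<close> modulo biadditivity and the relations
  \<open>c x \<otimes> y = x \<otimes> c y\<close>; scalars act by \<open>c (x \<otimes> y) = c x \<otimes> y\<close>.\<close>

definition tensor_free ::
  "('r, 'a, 'n) module_scheme \<Rightarrow> ('r, 'b, 'p) module_scheme \<Rightarrow> ('a \<times> 'b \<Rightarrow>\<^sub>0 int) monoid"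
  where "tensor_free V W = free_Abelian_group (carrier V \<times> carrier W)"

definition tensor_rels ::
  "('r, 'm) ring_scheme \<Rightarrow> ('r, 'a, 'n) module_scheme \<Rightarrow> ('r, 'b, 'p) module_scheme \<Rightarrow>
   ('a \<times> 'b \<Rightarrow>\<^sub>0 int) set"
  where "tensor_rels R V W =
    {frag_of (x \<oplus>\<^bsub>V\<^esub> x', y) - frag_of (x, y) - frag_of (x', y) | x x' y.
       x \<in> carrier V \<and> x' \<in> carrier V \<and> y \<in> carrier W} \<union>
    {frag_of (x, y \<oplus>\<^bsub>W\<^esub> y') - frag_of (x, y) - frag_of (x, y') | x y y'.
       x \<in> carrier V \<and> y \<in> carrier W \<and> y' \<in> carrier W} \<union>
    {frag_of (c \<odot>\<^bsub>V\<^esub> x, y) - frag_of (x, c \<odot>\<^bsub>W\<^esub> y) | c x y.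
       c \<in> carrier R \<and> x \<in> carrier V \<and> y \<in> carrier W}"

definition tensor_ker ::
  "('r, 'm) ring_scheme \<Rightarrow> ('r, 'a, 'n) module_scheme \<Rightarrow> ('r, 'b, 'p) module_scheme \<Rightarrow>
   ('a \<times> 'b \<Rightarrow>\<^sub>0 int) set"
  where "tensor_ker R V W = generate (tensor_free V W) (tensor_rels R V W)"

text \<open>The multiplicative fields of a module record carry no meaning and are left undefined.
  For a coset \<open>T\<close> the set \<open>c \<odot> T\<close> below is the coset containing the image of \<open>T\<close> under
  \<open>(x, y) \<mapsto> (c x, y)\<close>.\<close>

definition tensor ::
  "('r, 'm) ring_scheme \<Rightarrow> ('r, 'a, 'n) module_scheme \<Rightarrow> ('r, 'b, 'p) module_scheme \<Rightarrow>
   ('r, ('a \<times> 'b \<Rightarrow>\<^sub>0 int) set) module"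
  where "tensor R V W =
    \<lparr>carrier = carrier (tensor_free V W Mod tensor_ker R V W),
     monoid.mult = undefined, one = undefined,
     ring.zero = \<one>\<^bsub>tensor_free V W Mod tensor_ker R V W\<^esub>,
     add = monoid.mult (tensor_free V W Mod tensor_ker R V W),
     smult = (\<lambda>c T. tensor_ker R V W <#>\<^bsub>tensor_free V W\<^esub>
                      frag_extend (\<lambda>(x, y). frag_of (c \<odot>\<^bsub>V\<^esub> x, y)) ` T)\<rparr>"

definition tensor_elem ::
  "('r, 'm) ring_scheme \<Rightarrow> ('r, 'a, 'n) module_scheme \<Rightarrow> ('r, 'b, 'p) module_scheme \<Rightarrow>
   'a \<Rightarrow> 'b \<Rightarrow> ('a \<times> 'b \<Rightarrow>\<^sub>0 int) set"
  where "tensor_elem R V W x y = tensor_ker R V W #>\<^bsub>tensor_free V W\<^esub> frag_of (x, y)"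


locale module_pair = V: module R V + W: module R W
  for R :: "('r, 'm) ring_scheme" and V :: "('r, 'a, 'n) module_scheme"
    and W :: "('r, 'b, 'p) module_scheme"
begin

abbreviation "F \<equiv> tensor_free V W"
abbreviation "N \<equiv> tensor_ker R V W"

lemma free_comm_group: "comm_group F"
  by (simp add: tensor_free_def abelian_free_Abelian_group)

sublocale F: comm_group F
  by (rule free_comm_group)

lemma free_simps [simp]:
  "p \<in> carrier F \<longleftrightarrow> Poly_Mapping.keys p \<subseteq> carrier V \<times> carrier W"
  "p \<otimes>\<^bsub>F\<^esub> q = p + q" "\<one>\<^bsub>F\<^esub> = 0"
  by (simp_all add: tensor_free_def)

lemma frag_of_closed: "x \<in> carrier V \<Longrightarrow> y \<in> carrier W \<Longrightarrow> frag_of (x, y) \<in> carrier F"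
  by simp

lemma free_diff: "p \<in> carrier F \<Longrightarrow> q \<in> carrier F \<Longrightarrow> p - q \<in> carrier F"
  using keys_diff[of p q] by auto

lemma free_hom_diff:
  assumes "group G" "h \<in> hom F G" "p \<in> carrier F" "q \<in> carrier F"
  shows "h (p - q) = h p \<otimes>\<^bsub>G\<^esub> inv\<^bsub>G\<^esub> h q"
proof -
  interpret h: group_hom F G h
    by (simp add: group_hom_def group_hom_axioms_def assms F.is_group)
  have "h (p - q) \<otimes>\<^bsub>G\<^esub> h q = h p"
    using h.hom_mult[OF free_diff[OF assms(3,4)] assms(4)] by simp
  moreover have "h p \<in> carrier G" "h q \<in> carrier G" "h (p - q) \<in> carrier G"
    using h.hom_closed free_diff assms by blast+
  ultimately show ?thesis
    using h.H.inv_solve_right' by metis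
qed

lemma rels_closed: "tensor_rels R V W \<subseteq> carrier F"
  unfolding tensor_rels_def by (auto intro!: free_diff frag_of_closed simp del: free_simps(1))

lemma ker_subgroup: "subgroup N F"
  unfolding tensor_ker_def by (rule F.generate_is_subgroup[OF rels_closed])

lemma ker_normal: "N \<lhd> F"
  by (rule F.subgroup_imp_normal[OF ker_subgroup])

lemma rels_ker: "p \<in> tensor_rels R V W \<Longrightarrow> p \<in> N"
  unfolding tensor_ker_def by (rule generate.incl)

abbreviation "T \<equiv> tensor R V W"
abbreviation cls where "cls p \<equiv> N #>\<^bsub>F\<^esub> p"

lemma T_abelian_group: "abelian_group T"
proof -
  interpret Q: comm_group "F Mod N"
    by (rule F.abelian_FactGroup[OF ker_subgroup])
  have c: "carrier T = carrier (F Mod N)" "\<And>s t. s \<oplus>\<^bsub>T\<^esub> t = s \<otimes>\<^bsub>F Mod N\<^esub> t"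
    "\<zero>\<^bsub>T\<^esub> = \<one>\<^bsub>F Mod N\<^esub>"
    by (simp_all add: tensor_def)
  show ?thesis
    by (rule abelian_groupI; unfold c)
      (assumption | rule Q.m_closed Q.one_closed Q.m_assoc Q.m_comm Q.l_one Q.l_inv_ex)+
qed

sublocale T: abelian_group T by (rule T_abelian_group)

lemma T_carrier: "carrier T = cls ` carrier F"
  by (simp add: tensor_def carrier_FactGroup)

lemma cls_closed: "p \<in> carrier F \<Longrightarrow> cls p \<in> carrier T"
  by (auto simp add: T_carrier simp del: free_simps(1))

lemma cls_add: "p \<in> carrier F \<Longrightarrow> q \<in> carrier F \<Longrightarrow> cls p \<oplus>\<^bsub>T\<^esub> cls q = cls (p + q)"
  using normal.rcos_sum[OF ker_normal, of p q] by (simp add: tensor_def)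

lemma cls_hom: "cls \<in> hom F (add_monoid T)"
  by (rule homI) (simp_all add: cls_closed cls_add)

lemma cls_eq_iff:
  assumes "p \<in> carrier F" "q \<in> carrier F"
  shows "cls p = cls q \<longleftrightarrow> p - q \<in> N"
proof -
  have "cls p = cls q \<longleftrightarrow> p \<in> cls q"
    using F.repr_independence[OF _ assms(2) ker_subgroup, of p] F.rcos_self[OF assms(1) ker_subgroup] by metis
  also have "\<dots> \<longleftrightarrow> p - q \<in> N"
    by (auto simp: r_coset_def) (metis diff_add_cancel)
  finally show ?thesis .
qed

lemma T_hom_eqI:
  assumes G: "group G" and f: "f \<in> hom (add_monoid T) G" and g: "g \<in> hom (add_monoid T) G"
    and eq: "\<And>x y. x \<in> carrier V \<Longrightarrow> y \<in> carrier W \<Longrightarrow>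
      f (tensor_elem R V W x y) = g (tensor_elem R V W x y)"
    and t: "t \<in> carrier T"
  shows "f t = g t"
proof -
  obtain p where p: "p \<in> carrier F" "t = cls p" using t T_carrier by auto
  have hf: "(f \<circ> cls) \<in> hom F G" and hg: "(g \<circ> cls) \<in> hom F G"
    using cls_hom f g hom_compose by blast+
  have "(f \<circ> cls) p = (g \<circ> cls) p"
  proof (rule free_Abelian_group_induct[OF p(1)[simplified]], goal_cases)
    case 1
    show ?case using hom_one[OF hf F.is_group G] hom_one[OF hg F.is_group G] by simp
  next
    case (2 p q)
    then show ?case
      using free_hom_diff[OF G hf, of p q] free_hom_diff[OF G hg, of p q] by simp
  next
    case (3 z)
    then show ?case using eq by (cases z) (auto simp: tensor_elem_def)
  qed
  then show ?thesis using p(2) by simp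
qed

lemma elem_closed: "x \<in> carrier V \<Longrightarrow> y \<in> carrier W \<Longrightarrow> tensor_elem R V W x y \<in> carrier T"
  unfolding tensor_elem_def by (intro cls_closed frag_of_closed)

lemma elem_add_left:
  assumes "x \<in> carrier V" "x' \<in> carrier V" "y \<in> carrier W"
  shows "tensor_elem R V W (x \<oplus>\<^bsub>V\<^esub> x') y = tensor_elem R V W x y \<oplus>\<^bsub>T\<^esub> tensor_elem R V W x' y"
proof -
  have "frag_of (x \<oplus>\<^bsub>V\<^esub> x', y) - frag_of (x, y) - frag_of (x', y) \<in> N"
    by (rule rels_ker) (use assms in \<open>unfold tensor_rels_def, blast\<close>)
  then have "cls (frag_of (x \<oplus>\<^bsub>V\<^esub> x', y)) = cls (frag_of (x, y) + frag_of (x', y))"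
    using assms F.m_closed[OF frag_of_closed frag_of_closed, of x y x' y]
    by (subst cls_eq_iff) (auto simp: diff_diff_add)
  then show ?thesis
    using assms by (simp add: tensor_elem_def cls_add)
qed

lemma elem_add_right:
  assumes "x \<in> carrier V" "y \<in> carrier W" "y' \<in> carrier W"
  shows "tensor_elem R V W x (y \<oplus>\<^bsub>W\<^esub> y') = tensor_elem R V W x y \<oplus>\<^bsub>T\<^esub> tensor_elem R V W x y'"
proof -
  have "frag_of (x, y \<oplus>\<^bsub>W\<^esub> y') - frag_of (x, y) - frag_of (x, y') \<in> N"
    by (rule rels_ker) (use assms in \<open>unfold tensor_rels_def, blast\<close>)
  then have "cls (frag_of (x, y \<oplus>\<^bsub>W\<^esub> y')) = cls (frag_of (x, y) + frag_of (x, y'))"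
    using assms F.m_closed[OF frag_of_closed frag_of_closed, of x y x y']
    by (subst cls_eq_iff) (auto simp: diff_diff_add)
  then show ?thesis
    using assms by (simp add: tensor_elem_def cls_add)
qed

lemma elem_balanced:
  assumes "c \<in> carrier R" "x \<in> carrier V" "y \<in> carrier W"
  shows "tensor_elem R V W (c \<odot>\<^bsub>V\<^esub> x) y = tensor_elem R V W x (c \<odot>\<^bsub>W\<^esub> y)"
proof -
  have "frag_of (c \<odot>\<^bsub>V\<^esub> x, y) - frag_of (x, c \<odot>\<^bsub>W\<^esub> y) \<in> N"
    by (rule rels_ker) (use assms in \<open>unfold tensor_rels_def, blast\<close>)
  then show ?thesis
    using assms unfolding tensor_elem_def by (subst cls_eq_iff) auto
qed

abbreviation scal where "scal c \<equiv> frag_extend (\<lambda>(x, y). frag_of (c \<odot>\<^bsub>V\<^esub> x, y))"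

lemma scal_hom: "c \<in> carrier R \<Longrightarrow> scal c \<in> hom F F"
  by (rule homI) (auto simp: frag_extend_add dest!: subsetD[OF keys_frag_extend])

lemma scal_rels:
  assumes c: "c \<in> carrier R" and p: "p \<in> tensor_rels R V W"
  shows "scal c p \<in> tensor_rels R V W"
  using p unfolding tensor_rels_def
proof (elim UnE CollectE exE conjE)
  fix x x' y
  assume *: "x \<in> carrier V" "x' \<in> carrier V" "y \<in> carrier W"
    "p = frag_of (x \<oplus>\<^bsub>V\<^esub> x', y) - frag_of (x, y) - frag_of (x', y)"
  have "scal c p = frag_of (c \<odot>\<^bsub>V\<^esub> x \<oplus>\<^bsub>V\<^esub> c \<odot>\<^bsub>V\<^esub> x', y) - frag_of (c \<odot>\<^bsub>V\<^esub> x, y) - frag_of (c \<odot>\<^bsub>V\<^esub> x', y)"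
    using * c by (simp add: frag_extend_diff V.smult_r_distr)
  then show "scal c p \<in> {frag_of (x \<oplus>\<^bsub>V\<^esub> x', y) - frag_of (x, y) - frag_of (x', y) | x x' y.
       x \<in> carrier V \<and> x' \<in> carrier V \<and> y \<in> carrier W} \<union>
    {frag_of (x, y \<oplus>\<^bsub>W\<^esub> y') - frag_of (x, y) - frag_of (x, y') | x y y'.
       x \<in> carrier V \<and> y \<in> carrier W \<and> y' \<in> carrier W} \<union>
    {frag_of (c \<odot>\<^bsub>V\<^esub> x, y) - frag_of (x, c \<odot>\<^bsub>W\<^esub> y) | c x y.
       c \<in> carrier R \<and> x \<in> carrier V \<and> y \<in> carrier W}"
    using * V.smult_closed[OF c *(1)] V.smult_closed[OF c *(2)] by blast
next
  fix x y y'
  assume *: "x \<in> carrier V" "y \<in> carrier W" "y' \<in> carrier W"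
    "p = frag_of (x, y \<oplus>\<^bsub>W\<^esub> y') - frag_of (x, y) - frag_of (x, y')"
  have "scal c p = frag_of (c \<odot>\<^bsub>V\<^esub> x, y \<oplus>\<^bsub>W\<^esub> y') - frag_of (c \<odot>\<^bsub>V\<^esub> x, y) - frag_of (c \<odot>\<^bsub>V\<^esub> x, y')"
    using * by (simp add: frag_extend_diff)
  then show "scal c p \<in> {frag_of (x \<oplus>\<^bsub>V\<^esub> x', y) - frag_of (x, y) - frag_of (x', y) | x x' y.
       x \<in> carrier V \<and> x' \<in> carrier V \<and> y \<in> carrier W} \<union>
    {frag_of (x, y \<oplus>\<^bsub>W\<^esub> y') - frag_of (x, y) - frag_of (x, y') | x y y'.
       x \<in> carrier V \<and> y \<in> carrier W \<and> y' \<in> carrier W} \<union>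
    {frag_of (c \<odot>\<^bsub>V\<^esub> x, y) - frag_of (x, c \<odot>\<^bsub>W\<^esub> y) | c x y.
       c \<in> carrier R \<and> x \<in> carrier V \<and> y \<in> carrier W}"
    using * V.smult_closed[OF c *(1)] by blast
next
  fix d x y
  assume *: "d \<in> carrier R" "x \<in> carrier V" "y \<in> carrier W"
    "p = frag_of (d \<odot>\<^bsub>V\<^esub> x, y) - frag_of (x, d \<odot>\<^bsub>W\<^esub> y)"
  have "c \<odot>\<^bsub>V\<^esub> (d \<odot>\<^bsub>V\<^esub> x) = d \<odot>\<^bsub>V\<^esub> (c \<odot>\<^bsub>V\<^esub> x)"
    using c * V.smult_assoc1 V.R.m_comm by metis
  then have "scal c p = frag_of (d \<odot>\<^bsub>V\<^esub> (c \<odot>\<^bsub>V\<^esub> x), y) - frag_of (c \<odot>\<^bsub>V\<^esub> x, d \<odot>\<^bsub>W\<^esub> y)"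
    using * by (simp add: frag_extend_diff)
  then show "scal c p \<in> {frag_of (x \<oplus>\<^bsub>V\<^esub> x', y) - frag_of (x, y) - frag_of (x', y) | x x' y.
       x \<in> carrier V \<and> x' \<in> carrier V \<and> y \<in> carrier W} \<union>
    {frag_of (x, y \<oplus>\<^bsub>W\<^esub> y') - frag_of (x, y) - frag_of (x, y') | x y y'.
       x \<in> carrier V \<and> y \<in> carrier W \<and> y' \<in> carrier W} \<union>
    {frag_of (c \<odot>\<^bsub>V\<^esub> x, y) - frag_of (x, c \<odot>\<^bsub>W\<^esub> y) | c x y.
       c \<in> carrier R \<and> x \<in> carrier V \<and> y \<in> carrier W}"
    using * V.smult_closed[OF c *(2)] by blast
qed

lemma scal_ker:
  assumes c: "c \<in> carrier R" and p: "p \<in> N"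
  shows "scal c p \<in> N"
  using p unfolding tensor_ker_def
proof (induction rule: generate.induct)
  case one
  then show ?case by (simp add: generate.one[of F, simplified])
next
  case (incl h)
  then show ?case using scal_rels[OF c] by (blast intro: generate.incl)
next
  case (inv h)
  have "inv\<^bsub>F\<^esub> h = - h"
    using inv rels_closed by (auto simp: tensor_free_def)
  moreover have "inv\<^bsub>F\<^esub> scal c h = - scal c h"
    using scal_rels[OF c inv] rels_closed by (auto simp: tensor_free_def)
  ultimately show ?case
    using generate.inv[OF scal_rels[OF c inv], of F] by (simp add: frag_extend_minus)
next
  case (eng h1 h2)
  then show ?case using generate.eng[OF eng(3,4)] by (simp add: frag_extend_add)
qed

lemma smult_cls:
  assumes c: "c \<in> carrier R" and p: "p \<in> carrier F"
  shows "c \<odot>\<^bsub>T\<^esub> cls p = cls (scal c p)"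
proof -
  have "c \<odot>\<^bsub>T\<^esub> cls p = {m + scal c (m' + p) | m m'. m \<in> N \<and> m' \<in> N}"
    unfolding tensor_def set_mult_def r_coset_def by auto
  also have "\<dots> = {m + scal c p | m. m \<in> N}"
  proof safe
    fix m m' assume m: "m \<in> N" "m' \<in> N"
    have "m + scal c m' \<in> N"
      using subgroup.m_closed[OF ker_subgroup m(1) scal_ker[OF c m(2)]] by simp
    then show "\<exists>ma. m + scal c (m' + p) = ma + scal c p \<and> ma \<in> N"
      by (intro exI[of _ "m + scal c m'"]) (simp add: frag_extend_add add.assoc)
  next
    fix m assume "m \<in> N"
    then show "\<exists>ma m'. m + scal c p = ma + scal c (m' + p) \<and> ma \<in> N \<and> m' \<in> N"
      using subgroup.one_closed[OF ker_subgroup] by (intro exI[of _ m] exI[of _ 0]) simp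
  qed
  also have "\<dots> = cls (scal c p)"
    unfolding r_coset_def by auto
  finally show ?thesis .
qed

lemma smult_elem:
  "c \<in> carrier R \<Longrightarrow> x \<in> carrier V \<Longrightarrow> y \<in> carrier W \<Longrightarrow>
    c \<odot>\<^bsub>T\<^esub> tensor_elem R V W x y = tensor_elem R V W (c \<odot>\<^bsub>V\<^esub> x) y"
  by (simp add: tensor_elem_def smult_cls)

lemma smult_hom:
  assumes c: "c \<in> carrier R"
  shows "(\<lambda>t. c \<odot>\<^bsub>T\<^esub> t) \<in> hom (add_monoid T) (add_monoid T)"
proof (rule homI)
  fix t assume "t \<in> carrier (add_monoid T)"
  then obtain p where p: "p \<in> carrier F" "t = cls p" using T_carrier by auto
  then show "c \<odot>\<^bsub>T\<^esub> t \<in> carrier (add_monoid T)"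
    using hom_in_carrier[OF scal_hom[OF c] p(1)] smult_cls[OF c p(1)] cls_closed by simp
next
  fix s t assume "s \<in> carrier (add_monoid T)" "t \<in> carrier (add_monoid T)"
  then obtain p q where pq: "p \<in> carrier F" "s = cls p" "q \<in> carrier F" "t = cls q"
    using T_carrier by auto
  have "p + q \<in> carrier F" using F.m_closed pq by fastforce
  then show "c \<odot>\<^bsub>T\<^esub> (s \<otimes>\<^bsub>add_monoid T\<^esub> t) = c \<odot>\<^bsub>T\<^esub> s \<otimes>\<^bsub>add_monoid T\<^esub> (c \<odot>\<^bsub>T\<^esub> t)"
    using pq hom_in_carrier[OF scal_hom[OF c] pq(1)] hom_in_carrier[OF scal_hom[OF c] pq(3)] c
    by (simp add: cls_add smult_cls frag_extend_add del: free_simps(1))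
qed

theorem tensor_module: "module R T"
proof -
  note G = T.a_group
  have hom_add: "(\<lambda>t. f t \<oplus>\<^bsub>T\<^esub> g t) \<in> hom (add_monoid T) (add_monoid T)"
    if "f \<in> hom (add_monoid T) (add_monoid T)" "g \<in> hom (add_monoid T) (add_monoid T)" for f g
    using that unfolding hom_def by (auto simp: Pi_def T.a_ac)
  have cl: "c \<odot>\<^bsub>T\<^esub> t \<in> carrier T" if "c \<in> carrier R" "t \<in> carrier T" for c t
    using hom_in_carrier[OF smult_hom[OF that(1)], of t] that(2) by simp
  show ?thesis
  proof (rule moduleI)
    show "cring R" by (rule V.R.is_cring)
    show "abelian_group T" by (rule T_abelian_group)
  next
    fix a x assume "a \<in> carrier R" "x \<in> carrier T"
    then show "a \<odot>\<^bsub>T\<^esub> x \<in> carrier T" by (rule cl)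
  next
    fix a b x assume *: "a \<in> carrier R" "b \<in> carrier R" "x \<in> carrier T"
    show "(a \<oplus>\<^bsub>R\<^esub> b) \<odot>\<^bsub>T\<^esub> x = a \<odot>\<^bsub>T\<^esub> x \<oplus>\<^bsub>T\<^esub> b \<odot>\<^bsub>T\<^esub> x"
      by (rule T_hom_eqI[OF G smult_hom hom_add[OF smult_hom smult_hom] _ *(3)])
        (use * in \<open>simp_all add: smult_elem V.smult_l_distr elem_add_left\<close>)
    show "(a \<otimes>\<^bsub>R\<^esub> b) \<odot>\<^bsub>T\<^esub> x = a \<odot>\<^bsub>T\<^esub> (b \<odot>\<^bsub>T\<^esub> x)"
      by (rule T_hom_eqI[OF G smult_hom hom_compose[OF smult_hom smult_hom, unfolded o_def] _ *(3)])
        (use * in \<open>simp_all add: smult_elem V.smult_assoc1\<close>)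
  next
    fix a x y assume "a \<in> carrier R" "x \<in> carrier T" "y \<in> carrier T"
    then show "a \<odot>\<^bsub>T\<^esub> (x \<oplus>\<^bsub>T\<^esub> y) = a \<odot>\<^bsub>T\<^esub> x \<oplus>\<^bsub>T\<^esub> a \<odot>\<^bsub>T\<^esub> y"
      using hom_mult[OF smult_hom, of a x y] by simp
  next
    fix x assume *: "x \<in> carrier T"
    show "\<one>\<^bsub>R\<^esub> \<odot>\<^bsub>T\<^esub> x = x"
      by (rule T_hom_eqI[OF G smult_hom _ _ *, of _ id, simplified])
        (auto simp: smult_elem hom_def)
  qed
qed

theorem tensor_universal:
  assumes P: "module R P" and b: "b \<in> bilin_hom R V W P"
  shows "\<exists>!h. h \<in> lin_hom R T P \<inter> extensional (carrier T) \<and>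
    (\<forall>x\<in>carrier V. \<forall>y\<in>carrier W. h (tensor_elem R V W x y) = b x y)"
proof (rule ex_ex1I)
  interpret P: module R P by (rule P)
  have bV: "b x \<in> lin_hom R W P" if "x \<in> carrier V" for x
    using b that by (simp add: bilin_hom_def)
  have bW: "(\<lambda>x. b x y) \<in> lin_hom R V P" if "y \<in> carrier W" for y
    using b that by (simp add: bilin_hom_def)
  have b_closed: "b x y \<in> carrier P" if "x \<in> carrier V" "y \<in> carrier W" for x y
    using bV[OF that(1)] that(2) by (auto simp: lin_hom_def)
  have "(\<lambda>(x, y). b x y) ` (carrier V \<times> carrier W) \<subseteq> carrier (add_monoid P)"
    using b_closed by auto
  then obtain h0 where h0: "h0 \<in> hom F (add_monoid P)"
    "\<And>z. z \<in> carrier V \<times> carrier W \<Longrightarrow> h0 (frag_of z) = (\<lambda>(x, y). b x y) z"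
    unfolding tensor_free_def using comm_group.free_Abelian_group_universal[OF P.a_comm_group] by blast
  interpret h0: group_hom F "add_monoid P" h0
    by (simp add: group_hom_def group_hom_axioms_def h0 F.is_group P.a_group)
  have h0_diff: "h0 (p - q) = h0 p \<ominus>\<^bsub>P\<^esub> h0 q" if "p \<in> carrier F" "q \<in> carrier F" for p q
    using free_hom_diff[OF P.a_group h0(1) that] by (simp add: a_minus_def a_inv_def)
  have "tensor_rels R V W \<subseteq> kernel F (add_monoid P) h0"
  proof
    fix p assume p: "p \<in> tensor_rels R V W"
    have "h0 p = \<zero>\<^bsub>P\<^esub>"
      using p unfolding tensor_rels_def
    proof (elim UnE CollectE exE conjE)
      fix x x' y
      assume *: "x \<in> carrier V" "x' \<in> carrier V" "y \<in> carrier W"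
        "p = frag_of (x \<oplus>\<^bsub>V\<^esub> x', y) - frag_of (x, y) - frag_of (x', y)"
      have "h0 p = b (x \<oplus>\<^bsub>V\<^esub> x') y \<ominus>\<^bsub>P\<^esub> b x y \<ominus>\<^bsub>P\<^esub> b x' y"
        using * h0_diff[OF free_diff[OF frag_of_closed frag_of_closed] frag_of_closed, of "x \<oplus>\<^bsub>V\<^esub> x'" y x y x' y]
          h0_diff[OF frag_of_closed frag_of_closed, of "x \<oplus>\<^bsub>V\<^esub> x'" y x y] by (simp add: h0(2))
      also have "b (x \<oplus>\<^bsub>V\<^esub> x') y = b x y \<oplus>\<^bsub>P\<^esub> b x' y"
        using bW[OF *(3)] * by (simp add: lin_hom_def)
      finally show ?thesis
        using b_closed[OF *(1,3)] b_closed[OF *(2,3)]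
        by (simp add: a_minus_def P.a_ac P.r_neg P.r_neg2)
    next
      fix x y y'
      assume *: "x \<in> carrier V" "y \<in> carrier W" "y' \<in> carrier W"
        "p = frag_of (x, y \<oplus>\<^bsub>W\<^esub> y') - frag_of (x, y) - frag_of (x, y')"
      have "h0 p = b x (y \<oplus>\<^bsub>W\<^esub> y') \<ominus>\<^bsub>P\<^esub> b x y \<ominus>\<^bsub>P\<^esub> b x y'"
        using * h0_diff[OF free_diff[OF frag_of_closed frag_of_closed] frag_of_closed, of x "y \<oplus>\<^bsub>W\<^esub> y'" x y x y']
          h0_diff[OF frag_of_closed frag_of_closed, of x "y \<oplus>\<^bsub>W\<^esub> y'" x y] by (simp add: h0(2))
      also have "b x (y \<oplus>\<^bsub>W\<^esub> y') = b x y \<oplus>\<^bsub>P\<^esub> b x y'"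
        using bV[OF *(1)] * by (simp add: lin_hom_def)
      finally show ?thesis
        using b_closed[OF *(1,2)] b_closed[OF *(1,3)]
        by (simp add: a_minus_def P.a_ac P.r_neg P.r_neg2)
    next
      fix c x y
      assume *: "c \<in> carrier R" "x \<in> carrier V" "y \<in> carrier W"
        "p = frag_of (c \<odot>\<^bsub>V\<^esub> x, y) - frag_of (x, c \<odot>\<^bsub>W\<^esub> y)"
      have "h0 p = b (c \<odot>\<^bsub>V\<^esub> x) y \<ominus>\<^bsub>P\<^esub> b x (c \<odot>\<^bsub>W\<^esub> y)"
        using * h0_diff[OF frag_of_closed frag_of_closed, of "c \<odot>\<^bsub>V\<^esub> x" y x "c \<odot>\<^bsub>W\<^esub> y"]
        by (simp add: h0(2))
      also have "b (c \<odot>\<^bsub>V\<^esub> x) y = b x (c \<odot>\<^bsub>W\<^esub> y)"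
        using bV[OF *(2)] bW[OF *(3)] * by (simp add: lin_hom_def)
      finally show ?thesis
        using b_closed[OF *(2) W.smult_closed[OF *(1,3)]] by (simp add: a_minus_def P.r_neg)
    qed
    then show "p \<in> kernel F (add_monoid P) h0"
      using subsetD[OF rels_closed p] by (simp add: kernel_def del: free_simps(1))
  qed
  then have "N \<subseteq> kernel F (add_monoid P) h0"
    unfolding tensor_ker_def by (rule F.generate_subgroup_incl[OF _ h0.subgroup_kernel])
  then obtain g where g: "g \<in> hom (F Mod N) (add_monoid P)"
    "\<And>p. p \<in> carrier F \<Longrightarrow> g (cls p) = h0 p"
    using h0.FactGroup_universal_kernel[OF ker_normal] by blast
  have gT: "g \<in> hom (add_monoid T) (add_monoid P)"
    using g(1) by (simp add: hom_def tensor_def)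
  have g_elem: "g (tensor_elem R V W x y) = b x y" if "x \<in> carrier V" "y \<in> carrier W" for x y
    using that by (simp add: tensor_elem_def g(2) h0(2))
  have g_smult: "g (c \<odot>\<^bsub>T\<^esub> t) = c \<odot>\<^bsub>P\<^esub> g t" if c: "c \<in> carrier R" and t: "t \<in> carrier T" for c t
  proof -
    have 1: "(g \<circ> (\<lambda>t. c \<odot>\<^bsub>T\<^esub> t)) \<in> hom (add_monoid T) (add_monoid P)"
      by (rule hom_compose[OF smult_hom[OF c] gT])
    have "(\<lambda>z. c \<odot>\<^bsub>P\<^esub> z) \<in> hom (add_monoid P) (add_monoid P)"
      using c by (auto simp: hom_def P.smult_r_distr)
    then have 2: "((\<lambda>z. c \<odot>\<^bsub>P\<^esub> z) \<circ> g) \<in> hom (add_monoid T) (add_monoid P)"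
      by (rule hom_compose[OF gT])
    have "b (c \<odot>\<^bsub>V\<^esub> x) y = c \<odot>\<^bsub>P\<^esub> b x y" if "x \<in> carrier V" "y \<in> carrier W" for x y
      using bW[OF that(2)] that(1) c by (simp add: lin_hom_def)
    then have "(g \<circ> (\<lambda>t. c \<odot>\<^bsub>T\<^esub> t)) t = ((\<lambda>z. c \<odot>\<^bsub>P\<^esub> z) \<circ> g) t"
      by (intro T_hom_eqI[OF P.a_group 1 2 _ t]) (use c in \<open>simp add: smult_elem g_elem\<close>)
    then show ?thesis by simp
  qed
  have "restrict g (carrier T) \<in> lin_hom R T P"
    using gT g_smult module.smult_closed[OF tensor_module] by (auto simp: lin_hom_def hom_def)
  then show "\<exists>h. h \<in> lin_hom R T P \<inter> extensional (carrier T) \<and>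
    (\<forall>x\<in>carrier V. \<forall>y\<in>carrier W. h (tensor_elem R V W x y) = b x y)"
    by (intro exI[of _ "restrict g (carrier T)"]) (auto simp: g_elem elem_closed)
next
  interpret P: module R P by (rule P)
  fix h k
  assume h: "h \<in> lin_hom R T P \<inter> extensional (carrier T) \<and>
      (\<forall>x\<in>carrier V. \<forall>y\<in>carrier W. h (tensor_elem R V W x y) = b x y)"
    and k: "k \<in> lin_hom R T P \<inter> extensional (carrier T) \<and>
      (\<forall>x\<in>carrier V. \<forall>y\<in>carrier W. k (tensor_elem R V W x y) = b x y)"
  have hk: "h \<in> hom (add_monoid T) (add_monoid P)" "k \<in> hom (add_monoid T) (add_monoid P)"
    using h k by (auto simp: lin_hom_def hom_def)
  show "h = k"
  proof (rule extensionalityI[of _ "carrier T"])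
    fix t assume "t \<in> carrier T"
    then show "h t = k t"
      by (rule T_hom_eqI[OF P.a_group hk, rotated]) (use h k in simp)
  qed (use h k in auto)
qed

theorem elem_bilin: "tensor_elem R V W \<in> bilin_hom R V W T"
  unfolding bilin_hom_def lin_hom_def
  by (auto simp: elem_closed elem_add_left elem_add_right smult_elem elem_balanced)

end

text \<open>The linear map induced by a bilinear map; it exists uniquely by
  \<open>tensor_universal\<close>.\<close>

definition tensor_lift ::
  "('r, 'm) ring_scheme \<Rightarrow> ('r, 'a, 'n) module_scheme \<Rightarrow> ('r, 'b, 'p) module_scheme \<Rightarrow>
   ('r, 'c, 'q) module_scheme \<Rightarrow> ('a \<Rightarrow> 'b \<Rightarrow> 'c) \<Rightarrow> ('a \<times> 'b \<Rightarrow>\<^sub>0 int) set \<Rightarrow> 'c"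
  where "tensor_lift R V W P b =
    (THE h. h \<in> lin_hom R (tensor R V W) P \<inter> extensional (carrier (tensor R V W)) \<and>
            (\<forall>x\<in>carrier V. \<forall>y\<in>carrier W. h (tensor_elem R V W x y) = b x y))"

text \<open>\<open>f \<otimes> g : V \<otimes> W \<rightarrow> V' \<otimes> W'\<close>.\<close>

definition tensor_map ::
  "('r, 'm) ring_scheme \<Rightarrow> ('r, 'a, 'n) module_scheme \<Rightarrow> ('r, 'b, 'p) module_scheme \<Rightarrow>
   ('r, 'c, 'q) module_scheme \<Rightarrow> ('r, 'd, 's) module_scheme \<Rightarrow> ('a \<Rightarrow> 'c) \<Rightarrow> ('b \<Rightarrow> 'd) \<Rightarrow>
   ('a \<times> 'b \<Rightarrow>\<^sub>0 int) set \<Rightarrow> ('c \<times> 'd \<Rightarrow>\<^sub>0 int) set"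
  where "tensor_map R V W V' W' f g =
    tensor_lift R V W (tensor R V' W') (\<lambda>x y. tensor_elem R V' W' (f x) (g y))"

text \<open>The canonical identifications \<open>(U \<otimes> V) \<otimes> W \<rightarrow> U \<otimes> (V \<otimes> W)\<close> and back.\<close>

definition tensor_assoc ::
  "('r, 'm) ring_scheme \<Rightarrow> ('r, 'a, 'n) module_scheme \<Rightarrow> ('r, 'b, 'p) module_scheme \<Rightarrow>
   ('r, 'c, 'q) module_scheme \<Rightarrow>
   (('a \<times> 'b \<Rightarrow>\<^sub>0 int) set \<times> 'c \<Rightarrow>\<^sub>0 int) set \<Rightarrow> ('a \<times> ('b \<times> 'c \<Rightarrow>\<^sub>0 int) set \<Rightarrow>\<^sub>0 int) set"
  where "tensor_assoc R U V W =
    tensor_lift R (tensor R U V) W (tensor R U (tensor R V W))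
      (\<lambda>t w. tensor_lift R U V (tensor R U (tensor R V W))
               (\<lambda>u v. tensor_elem R U (tensor R V W) u (tensor_elem R V W v w)) t)"

definition tensor_assoc_inv ::
  "('r, 'm) ring_scheme \<Rightarrow> ('r, 'a, 'n) module_scheme \<Rightarrow> ('r, 'b, 'p) module_scheme \<Rightarrow>
   ('r, 'c, 'q) module_scheme \<Rightarrow>
   ('a \<times> ('b \<times> 'c \<Rightarrow>\<^sub>0 int) set \<Rightarrow>\<^sub>0 int) set \<Rightarrow> (('a \<times> 'b \<Rightarrow>\<^sub>0 int) set \<times> 'c \<Rightarrow>\<^sub>0 int) set"
  where "tensor_assoc_inv R U V W =
    tensor_lift R U (tensor R V W) (tensor R (tensor R U V) W)
      (\<lambda>u t. tensor_lift R V W (tensor R (tensor R U V) W)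
               (\<lambda>v w. tensor_elem R (tensor R U V) W (tensor_elem R U V u v) w) t)"

lemma lin_hom_closed: "f \<in> lin_hom R V W \<Longrightarrow> x \<in> carrier V \<Longrightarrow> f x \<in> carrier W"
  by (auto simp: lin_hom_def)

lemma lin_hom_comp: "f \<in> lin_hom R U V \<Longrightarrow> g \<in> lin_hom R V W \<Longrightarrow> (\<lambda>x. g (f x)) \<in> lin_hom R U W"
  by (auto simp: lin_hom_def Pi_def)

context module_pair
begin

lemma tensor_lift:
  assumes "module R P" "b \<in> bilin_hom R V W P"
  shows tensor_lift_linear: "tensor_lift R V W P b \<in> lin_hom R T P"
    and tensor_lift_elem: "\<And>x y. x \<in> carrier V \<Longrightarrow> y \<in> carrier W \<Longrightarrow>
      tensor_lift R V W P b (tensor_elem R V W x y) = b x y"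
  using theI'[OF tensor_universal[OF assms]] unfolding tensor_lift_def by auto

lemma T_linear_eqI:
  assumes P: "module R P" and f: "f \<in> lin_hom R T P" and g: "g \<in> lin_hom R T P"
    and eq: "\<And>x y. x \<in> carrier V \<Longrightarrow> y \<in> carrier W \<Longrightarrow>
      f (tensor_elem R V W x y) = g (tensor_elem R V W x y)"
    and t: "t \<in> carrier T"
  shows "f t = g t"
proof -
  interpret P: module R P by (rule P)
  have "f \<in> hom (add_monoid T) (add_monoid P)" "g \<in> hom (add_monoid T) (add_monoid P)"
    using f g by (auto simp: lin_hom_def hom_def)
  from T_hom_eqI[OF P.a_group this eq t] show ?thesis .
qed

lemma elem_lin_left: "y \<in> carrier W \<Longrightarrow> (\<lambda>x. tensor_elem R V W x y) \<in> lin_hom R V T"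
  using elem_bilin by (simp add: bilin_hom_def)

lemma elem_lin_right: "x \<in> carrier V \<Longrightarrow> tensor_elem R V W x \<in> lin_hom R W T"
  using elem_bilin by (simp add: bilin_hom_def)

end

lemma module_pairI: "module R V \<Longrightarrow> module R W \<Longrightarrow> module_pair R V W"
  by (simp add: module_pair_def)

lemma tensor_map:
  assumes "module R V" "module R W" "module R V'" "module R W'"
    and f: "f \<in> lin_hom R V V'" and g: "g \<in> lin_hom R W W'"
  shows tensor_map_linear: "tensor_map R V W V' W' f g \<in> lin_hom R (tensor R V W) (tensor R V' W')"
    and tensor_map_elem: "\<And>x y. x \<in> carrier V \<Longrightarrow> y \<in> carrier W \<Longrightarrow>
      tensor_map R V W V' W' f g (tensor_elem R V W x y) = tensor_elem R V' W' (f x) (g y)"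
proof -
  interpret D: module_pair R V W by (rule module_pairI) fact+
  interpret E: module_pair R V' W' by (rule module_pairI) fact+
  have "(\<lambda>x y. tensor_elem R V' W' (f x) (g y)) \<in> bilin_hom R V W (tensor R V' W')"
    unfolding bilin_hom_def
    using lin_hom_comp[OF f E.elem_lin_left] lin_hom_comp[OF g E.elem_lin_right] f g
    by (auto simp: lin_hom_def Pi_def)
  from D.tensor_lift[OF E.tensor_module this]
  show "tensor_map R V W V' W' f g \<in> lin_hom R (tensor R V W) (tensor R V' W')"
    "\<And>x y. x \<in> carrier V \<Longrightarrow> y \<in> carrier W \<Longrightarrow>
      tensor_map R V W V' W' f g (tensor_elem R V W x y) = tensor_elem R V' W' (f x) (g y)"
    by (simp_all add: tensor_map_def)
qed

lemma lin_hom_add: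
  assumes "module R V" "module R P" "f \<in> lin_hom R V P" "g \<in> lin_hom R V P"
  shows "(\<lambda>x. f x \<oplus>\<^bsub>P\<^esub> g x) \<in> lin_hom R V P"
proof -
  interpret P: module R P by fact
  show ?thesis using assms(3,4) by (auto simp: lin_hom_def Pi_def P.a_ac P.smult_r_distr)
qed

lemma lin_hom_smult:
  assumes "module R V" "module R P" "c \<in> carrier R" "f \<in> lin_hom R V P"
  shows "(\<lambda>x. c \<odot>\<^bsub>P\<^esub> f x) \<in> lin_hom R V P"
proof -
  interpret P: module R P by fact
  have "c \<odot>\<^bsub>P\<^esub> (d \<odot>\<^bsub>P\<^esub> z) = d \<odot>\<^bsub>P\<^esub> (c \<odot>\<^bsub>P\<^esub> z)" if "d \<in> carrier R" "z \<in> carrier P" for d z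
    using assms(3) that P.smult_assoc1 P.R.m_comm by metis
  then show ?thesis using assms(3,4) by (auto simp: lin_hom_def Pi_def P.smult_r_distr)
qed

lemma tensor_assoc:
  assumes "module R U" "module R V" "module R W"
  shows tensor_assoc_linear: "tensor_assoc R U V W \<in>
      lin_hom R (tensor R (tensor R U V) W) (tensor R U (tensor R V W))"
    and tensor_assoc_elem: "\<And>u v w. u \<in> carrier U \<Longrightarrow> v \<in> carrier V \<Longrightarrow> w \<in> carrier W \<Longrightarrow>
      tensor_assoc R U V W (tensor_elem R (tensor R U V) W (tensor_elem R U V u v) w) =
      tensor_elem R U (tensor R V W) u (tensor_elem R V W v w)"
proof -
  interpret UV: module_pair R U V by (rule module_pairI) fact+
  interpret VW: module_pair R V W by (rule module_pairI) fact+
  interpret L: module_pair R "tensor R U V" W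
    by (rule module_pairI) (fact | rule UV.tensor_module)+
  interpret M: module_pair R U "tensor R V W"
    by (rule module_pairI) (fact | rule VW.tensor_module)+
  note P = M.tensor_module
  let ?P = "tensor R U (tensor R V W)"
  define b where "b = (\<lambda>w u v. tensor_elem R U (tensor R V W) u (tensor_elem R V W v w))"
  have b: "b w \<in> bilin_hom R U V ?P" if "w \<in> carrier W" for w
    unfolding bilin_hom_def b_def
    using lin_hom_comp[OF VW.elem_lin_left[OF that] M.elem_lin_right]
      M.elem_lin_left[OF VW.elem_closed[OF _ that]] by auto
  note l = UV.tensor_lift_linear[OF P b] and e = UV.tensor_lift_elem[OF P b]
  have bw: "(\<lambda>w. b w u v) \<in> lin_hom R W ?P" if "u \<in> carrier U" "v \<in> carrier V" for u v
    unfolding b_def using lin_hom_comp[OF VW.elem_lin_right[OF that(2)] M.elem_lin_right[OF that(1)]] .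
  have "(\<lambda>w. tensor_lift R U V ?P (b w) t) \<in> lin_hom R W ?P" if t: "t \<in> carrier (tensor R U V)" for t
    unfolding lin_hom_def
  proof (intro CollectI conjI ballI Pi_I)
    fix w assume "w \<in> carrier W"
    then show "tensor_lift R U V ?P (b w) t \<in> carrier ?P"
      by (rule lin_hom_closed[OF l t])
  next
    fix w w' assume w: "w \<in> carrier W" "w' \<in> carrier W"
    show "tensor_lift R U V ?P (b (w \<oplus>\<^bsub>W\<^esub> w')) t =
      tensor_lift R U V ?P (b w) t \<oplus>\<^bsub>?P\<^esub> tensor_lift R U V ?P (b w') t"
      by (rule UV.T_linear_eqI[OF P l lin_hom_add[OF UV.tensor_module P l l] _ t])
        (use w bw in \<open>auto simp: e lin_hom_def\<close>)
  next
    fix c w assume w: "c \<in> carrier R" "w \<in> carrier W"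
    show "tensor_lift R U V ?P (b (c \<odot>\<^bsub>W\<^esub> w)) t = c \<odot>\<^bsub>?P\<^esub> tensor_lift R U V ?P (b w) t"
      by (rule UV.T_linear_eqI[OF P l lin_hom_smult[OF UV.tensor_module P _ l] _ t])
        (use w bw in \<open>auto simp: e lin_hom_def\<close>)
  qed
  then have B: "(\<lambda>t w. tensor_lift R U V ?P (b w) t) \<in> bilin_hom R (tensor R U V) W ?P"
    unfolding bilin_hom_def using l by auto
  show "tensor_assoc R U V W \<in> lin_hom R (tensor R (tensor R U V) W) ?P"
    using L.tensor_lift_linear[OF P B] by (simp add: tensor_assoc_def b_def)
  show "tensor_assoc R U V W (tensor_elem R (tensor R U V) W (tensor_elem R U V u v) w) =
      tensor_elem R U (tensor R V W) u (tensor_elem R V W v w)"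
    if "u \<in> carrier U" "v \<in> carrier V" "w \<in> carrier W" for u v w
    using L.tensor_lift_elem[OF P B UV.elem_closed[OF that(1,2)] that(3)] e[OF that(3,1,2)]
    by (simp add: tensor_assoc_def b_def)
qed

lemma tensor_assoc_inv:
  assumes "module R U" "module R V" "module R W"
  shows tensor_assoc_inv_linear: "tensor_assoc_inv R U V W \<in>
      lin_hom R (tensor R U (tensor R V W)) (tensor R (tensor R U V) W)"
    and tensor_assoc_inv_elem: "\<And>u v w. u \<in> carrier U \<Longrightarrow> v \<in> carrier V \<Longrightarrow> w \<in> carrier W \<Longrightarrow>
      tensor_assoc_inv R U V W (tensor_elem R U (tensor R V W) u (tensor_elem R V W v w)) =
      tensor_elem R (tensor R U V) W (tensor_elem R U V u v) w"
proof -
  interpret UV: module_pair R U V by (rule module_pairI) fact+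
  interpret VW: module_pair R V W by (rule module_pairI) fact+
  interpret L: module_pair R "tensor R U V" W
    by (rule module_pairI) (fact | rule UV.tensor_module)+
  interpret M: module_pair R U "tensor R V W"
    by (rule module_pairI) (fact | rule VW.tensor_module)+
  note P = L.tensor_module
  let ?P = "tensor R (tensor R U V) W"
  define b where "b = (\<lambda>u v w. tensor_elem R (tensor R U V) W (tensor_elem R U V u v) w)"
  have b: "b u \<in> bilin_hom R V W ?P" if "u \<in> carrier U" for u
    unfolding bilin_hom_def b_def
    using lin_hom_comp[OF UV.elem_lin_right[OF that] L.elem_lin_left]
      L.elem_lin_right[OF UV.elem_closed[OF that]] by auto
  note l = VW.tensor_lift_linear[OF P b] and e = VW.tensor_lift_elem[OF P b]
  have bu: "(\<lambda>u. b u v w) \<in> lin_hom R U ?P" if "v \<in> carrier V" "w \<in> carrier W" for v w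
    unfolding b_def using lin_hom_comp[OF UV.elem_lin_left[OF that(1)] L.elem_lin_left[OF that(2)]] .
  have "(\<lambda>u. tensor_lift R V W ?P (b u) t) \<in> lin_hom R U ?P" if t: "t \<in> carrier (tensor R V W)" for t
    unfolding lin_hom_def
  proof (intro CollectI conjI ballI Pi_I)
    fix u assume "u \<in> carrier U"
    then show "tensor_lift R V W ?P (b u) t \<in> carrier ?P"
      by (rule lin_hom_closed[OF l t])
  next
    fix u u' assume u: "u \<in> carrier U" "u' \<in> carrier U"
    show "tensor_lift R V W ?P (b (u \<oplus>\<^bsub>U\<^esub> u')) t =
      tensor_lift R V W ?P (b u) t \<oplus>\<^bsub>?P\<^esub> tensor_lift R V W ?P (b u') t"
      by (rule VW.T_linear_eqI[OF P l lin_hom_add[OF VW.tensor_module P l l] _ t])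
        (use u bu in \<open>auto simp: e lin_hom_def\<close>)
  next
    fix c u assume u: "c \<in> carrier R" "u \<in> carrier U"
    show "tensor_lift R V W ?P (b (c \<odot>\<^bsub>U\<^esub> u)) t = c \<odot>\<^bsub>?P\<^esub> tensor_lift R V W ?P (b u) t"
      by (rule VW.T_linear_eqI[OF P l lin_hom_smult[OF VW.tensor_module P _ l] _ t])
        (use u bu in \<open>auto simp: e lin_hom_def\<close>)
  qed
  then have B: "(\<lambda>u t. tensor_lift R V W ?P (b u) t) \<in> bilin_hom R U (tensor R V W) ?P"
    unfolding bilin_hom_def using l by auto
  show "tensor_assoc_inv R U V W \<in> lin_hom R (tensor R U (tensor R V W)) ?P"
    using M.tensor_lift_linear[OF P B] by (simp add: tensor_assoc_inv_def b_def)
  show "tensor_assoc_inv R U V W (tensor_elem R U (tensor R V W) u (tensor_elem R V W v w)) =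
      tensor_elem R (tensor R U V) W (tensor_elem R U V u v) w"
    if "u \<in> carrier U" "v \<in> carrier V" "w \<in> carrier W" for u v w
    using M.tensor_lift_elem[OF P B that(1) VW.elem_closed[OF that(2,3)]] e[OF that]
    by (simp add: tensor_assoc_inv_def b_def)
qed

section \<open>Hom-algebras, Hom-coalgebras and infinitesimal Hom-bialgebras\<close>

text \<open>Equations between linear maps are stated on carriers, as functions are unconstrained outside.\<close>

locale hom_associative_algebra = field R + module R A
  for R (structure) and A (structure) +
  fixes \<mu> :: "('a \<times> 'a \<Rightarrow>\<^sub>0 int) set \<Rightarrow> 'a" and \<alpha> :: "'a \<Rightarrow> 'a"
  assumes mu_linear: "\<mu> \<in> lin_hom R (tensor R A A) A"
    and alpha_linear: "\<alpha> \<in> lin_hom R A A"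
    and alpha_mu:
      "\<forall>t\<in>carrier (tensor R A A). \<alpha> (\<mu> t) = \<mu> (tensor_map R A A A A \<alpha> \<alpha> t)"
    and hom_assoc:
      "\<forall>t\<in>carrier (tensor R A (tensor R A A)).
         \<mu> (tensor_map R A (tensor R A A) A A \<alpha> \<mu> t) =
         \<mu> (tensor_map R (tensor R A A) A A A \<mu> \<alpha> (tensor_assoc_inv R A A A t))"

locale hom_coassociative_coalgebra = field R + module R A
  for R (structure) and A (structure) +
  fixes \<Delta> :: "'a \<Rightarrow> ('a \<times> 'a \<Rightarrow>\<^sub>0 int) set" and \<alpha> :: "'a \<Rightarrow> 'a"
  assumes delta_linear: "\<Delta> \<in> lin_hom R A (tensor R A A)"
    and alpha_linear: "\<alpha> \<in> lin_hom R A A"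
    and delta_alpha:
      "\<forall>x\<in>carrier A. tensor_map R A A A A \<alpha> \<alpha> (\<Delta> x) = \<Delta> (\<alpha> x)"
    and hom_coassoc:
      "\<forall>x\<in>carrier A.
         tensor_map R A A A (tensor R A A) \<alpha> \<Delta> (\<Delta> x) =
         tensor_assoc R A A A (tensor_map R A A (tensor R A A) A \<Delta> \<alpha> (\<Delta> x))"

locale epsilon_hom_bialgebra =
  hom_associative_algebra R A \<mu> \<alpha> + hom_coassociative_coalgebra R A \<Delta> \<alpha>
  for R (structure) and A (structure) and \<mu> and \<Delta> and \<alpha> +
  assumes delta_mu:
    "\<forall>t\<in>carrier (tensor R A A).
       \<Delta> (\<mu> t) =
         tensor_map R (tensor R A A) A A A \<mu> \<alpha>
           (tensor_assoc_inv R A A A (tensor_map R A A A (tensor R A A) \<alpha> \<Delta> t))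
         \<oplus>\<^bsub>tensor R A A\<^esub>
         tensor_map R A (tensor R A A) A A \<alpha> \<mu>
           (tensor_assoc R A A A (tensor_map R A A (tensor R A A) A \<Delta> \<alpha> t))"

end

(* The twist works for every power, not just 2^n - 1: with g = \<alpha>^k, the maps g o \<mu>, \<Delta> o g and
   \<alpha> o g again form an infinitesimal Hom-bialgebra. Since \<alpha> commutes with \<mu> and \<Delta>, g (x) g can
   be split off each composite, e.g. (g o \<mu>) (x) (\<alpha> o g) = (g (x) g) o (\<mu> (x) \<alpha>). After that, both
   sides of every axiom differ from those for (\<mu>, \<Delta>, \<alpha>) by pre- and postcomposition with powers
   of \<alpha>, so the associativity isomorphisms never have to be moved past anything. *)
theory Submission
  imports Defs
begin

section \<open>Functoriality of the tensor product of linear maps\<close>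

lemma tensor_map_comp:
  assumes V: "module R V" "module R V'" "module R V''"
    and W: "module R W" "module R W'" "module R W''"
    and f: "f \<in> lin_hom R V V'" and f': "f' \<in> lin_hom R V' V''"
    and g: "g \<in> lin_hom R W W'" and g': "g' \<in> lin_hom R W' W''"
    and t: "t \<in> carrier (tensor R V W)"
  shows "tensor_map R V W V'' W'' (f' \<circ> f) (g' \<circ> g) t =
    tensor_map R V' W' V'' W'' f' g' (tensor_map R V W V' W' f g t)"
proof -
  interpret VW: module_pair R V W by (rule module_pairI) fact+
  interpret VW'': module_pair R V'' W'' by (rule module_pairI) fact+
  have ff: "f' \<circ> f \<in> lin_hom R V V''" and gg: "g' \<circ> g \<in> lin_hom R W W''"
    using lin_hom_comp[OF f f'] lin_hom_comp[OF g g'] by (simp_all add: comp_def)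
  note outer = tensor_map[OF V(2) W(2) V(3) W(3) f' g']
    and inner = tensor_map[OF V(1) W(1) V(2) W(2) f g]
    and whole = tensor_map[OF V(1) W(1) V(3) W(3) ff gg]
  show ?thesis
    \<comment> \<open>Both sides are linear in \<open>t\<close>, and a linear map out of a tensor
      product is determined by its values on elementary tensors, where the claim is a direct
      evaluation.\<close>
    by (rule VW.T_linear_eqI[OF VW''.tensor_module whole(1) lin_hom_comp[OF inner(1) outer(1)] _ t])
      (simp add: whole(2) inner(2) outer(2) lin_hom_closed[OF f] lin_hom_closed[OF g])
qed

lemma lin_hom_funpow: "f \<in> lin_hom R V V \<Longrightarrow> f ^^ k \<in> lin_hom R V V"
proof (induction k)
  case 0
  then show ?case by (simp add: lin_hom_def)
next
  case (Suc k)
  then show ?case using lin_hom_comp[of "f ^^ k" R V V f V] by (simp add: comp_def)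
qed

text \<open>Supplies the power 0 in the inductions on k below. Since \<open>tensor_map\<close> is
  obtained by unique choice, its value at two identities has to be recognised through uniqueness on
  elementary tensors.\<close>

lemma tensor_map_id:
  assumes V: "module R V" and W: "module R W" and t: "t \<in> carrier (tensor R V W)"
  shows "tensor_map R V W V W id id t = t"
proof -
  interpret module_pair R V W by (rule module_pairI) fact+
  have V_id: "id \<in> lin_hom R V V" and W_id: "id \<in> lin_hom R W W"
    and T_id: "id \<in> lin_hom R (tensor R V W) (tensor R V W)"
    by (simp_all add: lin_hom_def)
  note map_id = tensor_map[OF V W V W V_id W_id]
  have "tensor_map R V W V W id id t = id t"
    by (rule T_linear_eqI[OF tensor_module map_id(1) T_id _ t]) (simp add: map_id(2))
  then show ?thesis by simp
qed

lemma tensor_map_funpow_Suc: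
  assumes V: "module R V" and W: "module R W" and f: "f \<in> lin_hom R V V" and g: "g \<in> lin_hom R W W"
    and t: "t \<in> carrier (tensor R V W)"
  shows "tensor_map R V W V W (f ^^ Suc k) (g ^^ Suc k) t =
    tensor_map R V W V W f g (tensor_map R V W V W (f ^^ k) (g ^^ k) t)"
  unfolding funpow.simps by (rule tensor_map_comp) (rule V W f g t lin_hom_funpow)+

lemma (in module) tensor_square_module: "module R (tensor R M M)"
  by (rule module_pair.tensor_module[OF module_pairI]) (rule module_axioms)+

section \<open>Twisting the product of a Hom-associative algebra\<close>

context hom_associative_algebra
begin

lemma alpha_funpow_linear: "\<alpha> ^^ k \<in> lin_hom R A A"
  by (rule lin_hom_funpow[OF alpha_linear])

lemma tensor_alpha_funpow_closed:
  "t \<in> carrier (tensor R A A) \<Longrightarrow>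
    tensor_map R A A A A (\<alpha> ^^ k) (\<alpha> ^^ k) t \<in> carrier (tensor R A A)"
  by (rule lin_hom_closed[OF tensor_map_linear])
    (rule module_axioms alpha_funpow_linear | assumption)+

text \<open>Iterates the multiplicativity of \<alpha>. It serves in both directions: to push a power
  of \<alpha> into the argument of \<mu>, and to pull one out of it.\<close>

lemma alpha_funpow_mu:
  assumes "t \<in> carrier (tensor R A A)"
  shows "(\<alpha> ^^ k) (\<mu> t) = \<mu> (tensor_map R A A A A (\<alpha> ^^ k) (\<alpha> ^^ k) t)"
proof (induction k)
  case 0
  show ?case
    using tensor_map_id[OF module_axioms module_axioms assms] by (simp add: id_def)
next
  case (Suc k)
  let ?g = "tensor_map R A A A A (\<alpha> ^^ k) (\<alpha> ^^ k)"
  have "(\<alpha> ^^ Suc k) (\<mu> t) = \<alpha> (\<mu> (?g t))"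
    using Suc by simp
  also have "\<dots> = \<mu> (tensor_map R A A A A \<alpha> \<alpha> (?g t))"
    using alpha_mu tensor_alpha_funpow_closed[OF assms] by blast
  finally show ?case
    unfolding tensor_map_funpow_Suc[OF module_axioms module_axioms alpha_linear alpha_linear assms] .
qed

lemma mu_funpow_linear: "(\<alpha> ^^ k) \<circ> \<mu> \<in> lin_hom R (tensor R A A) A"
  using lin_hom_comp[OF mu_linear alpha_funpow_linear] by (simp add: comp_def)

lemma tensor_alpha_mu_funpow:
  assumes "t \<in> carrier (tensor R A (tensor R A A))"
  shows "tensor_map R A (tensor R A A) A A (\<alpha> ^^ Suc k) ((\<alpha> ^^ k) \<circ> \<mu>) t =
    tensor_map R A A A A (\<alpha> ^^ k) (\<alpha> ^^ k) (tensor_map R A (tensor R A A) A A \<alpha> \<mu> t)"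
  \<comment> \<open>Peeling \<alpha> off on the right, as \<alpha>^k o \<alpha>, leaves \<alpha>^k
    outermost in both tensor factors, so \<open>tensor_map_comp\<close> applies.\<close>
  unfolding funpow_Suc_right
  by (rule tensor_map_comp)
    (rule module_axioms tensor_square_module alpha_funpow_linear alpha_linear mu_linear assms)+

lemma tensor_mu_alpha_funpow:
  assumes "t \<in> carrier (tensor R (tensor R A A) A)"
  shows "tensor_map R (tensor R A A) A A A ((\<alpha> ^^ k) \<circ> \<mu>) (\<alpha> ^^ Suc k) t =
    tensor_map R A A A A (\<alpha> ^^ k) (\<alpha> ^^ k) (tensor_map R (tensor R A A) A A A \<mu> \<alpha> t)"
  unfolding funpow_Suc_right
  by (rule tensor_map_comp)
    (rule module_axioms tensor_square_module alpha_funpow_linear alpha_linear mu_linear assms)+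

lemma tensor_alpha_mu_linear:
  "tensor_map R A (tensor R A A) A A \<alpha> \<mu> \<in> lin_hom R (tensor R A (tensor R A A)) (tensor R A A)"
  by (rule tensor_map_linear) (rule module_axioms tensor_square_module alpha_linear mu_linear)+

lemma tensor_mu_alpha_linear:
  "tensor_map R (tensor R A A) A A A \<mu> \<alpha> \<in> lin_hom R (tensor R (tensor R A A) A) (tensor R A A)"
  by (rule tensor_map_linear) (rule module_axioms tensor_square_module alpha_linear mu_linear)+

text \<open>The two sides of the twisted Hom-associativity are \<alpha>^(2k) applied to the two
  sides of the original one: one \<alpha>^k comes from the outer product, the other from the inner
  product and the enlarged twisting map.\<close>

lemma hom_associative_algebra_funpow:
  "hom_associative_algebra R A ((\<alpha> ^^ k) \<circ> \<mu>) (\<alpha> ^^ Suc k)"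
proof unfold_locales
  show "(\<alpha> ^^ k) \<circ> \<mu> \<in> lin_hom R (tensor R A A) A"
    by (rule mu_funpow_linear)
  show "\<alpha> ^^ Suc k \<in> lin_hom R A A"
    by (rule alpha_funpow_linear)
  show "\<forall>t\<in>carrier (tensor R A A). (\<alpha> ^^ Suc k) (((\<alpha> ^^ k) \<circ> \<mu>) t) =
      ((\<alpha> ^^ k) \<circ> \<mu>) (tensor_map R A A A A (\<alpha> ^^ Suc k) (\<alpha> ^^ Suc k) t)"
  proof
    fix t assume t: "t \<in> carrier (tensor R A A)"
    \<comment> \<open>Powers of \<alpha> commute, so multiplicativity of \<alpha>^(k+1) can be used
      underneath \<alpha>^k.\<close>
    have "(\<alpha> ^^ Suc k) ((\<alpha> ^^ k) (\<mu> t)) = (\<alpha> ^^ k) ((\<alpha> ^^ Suc k) (\<mu> t))"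
      by (simp add: funpow_swap1)
    then show "(\<alpha> ^^ Suc k) (((\<alpha> ^^ k) \<circ> \<mu>) t) =
        ((\<alpha> ^^ k) \<circ> \<mu>) (tensor_map R A A A A (\<alpha> ^^ Suc k) (\<alpha> ^^ Suc k) t)"
      using alpha_funpow_mu[OF t, of "Suc k"] by (simp only: comp_apply)
  qed
  show "\<forall>t\<in>carrier (tensor R A (tensor R A A)).
      ((\<alpha> ^^ k) \<circ> \<mu>) (tensor_map R A (tensor R A A) A A (\<alpha> ^^ Suc k) ((\<alpha> ^^ k) \<circ> \<mu>) t) =
      ((\<alpha> ^^ k) \<circ> \<mu>) (tensor_map R (tensor R A A) A A A ((\<alpha> ^^ k) \<circ> \<mu>) (\<alpha> ^^ Suc k)
        (tensor_assoc_inv R A A A t))"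
  proof
    fix t assume t: "t \<in> carrier (tensor R A (tensor R A A))"
    have t': "tensor_assoc_inv R A A A t \<in> carrier (tensor R (tensor R A A) A)"
      by (rule lin_hom_closed[OF tensor_assoc_inv_linear t]) (rule module_axioms)+
    show "((\<alpha> ^^ k) \<circ> \<mu>) (tensor_map R A (tensor R A A) A A (\<alpha> ^^ Suc k) ((\<alpha> ^^ k) \<circ> \<mu>) t) =
        ((\<alpha> ^^ k) \<circ> \<mu>) (tensor_map R (tensor R A A) A A A ((\<alpha> ^^ k) \<circ> \<mu>) (\<alpha> ^^ Suc k)
          (tensor_assoc_inv R A A A t))"
      \<comment> \<open>Read from right to left, multiplicativity moves the split-off \<alpha>^k (x)
        \<alpha>^k out through \<mu>; \<open>hom_assoc\<close> then matches what remains
        inside.\<close>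
      using hom_assoc t
        alpha_funpow_mu[OF lin_hom_closed[OF tensor_alpha_mu_linear t], of k, symmetric]
        alpha_funpow_mu[OF lin_hom_closed[OF tensor_mu_alpha_linear t'], of k, symmetric]
      by (simp only: comp_apply tensor_alpha_mu_funpow[OF t] tensor_mu_alpha_funpow[OF t'])
  qed
qed

end

section \<open>Twisting the coproduct of a Hom-coassociative coalgebra\<close>

context hom_coassociative_coalgebra
begin

lemma alpha_funpow_linear: "\<alpha> ^^ k \<in> lin_hom R A A"
  by (rule lin_hom_funpow[OF alpha_linear])

lemma delta_closed: "x \<in> carrier A \<Longrightarrow> \<Delta> x \<in> carrier (tensor R A A)"
  by (rule lin_hom_closed[OF delta_linear])

lemma alpha_funpow_closed: "x \<in> carrier A \<Longrightarrow> (\<alpha> ^^ k) x \<in> carrier A"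
  by (rule lin_hom_closed[OF alpha_funpow_linear])

lemma delta_alpha_funpow:
  assumes "x \<in> carrier A"
  shows "tensor_map R A A A A (\<alpha> ^^ k) (\<alpha> ^^ k) (\<Delta> x) = \<Delta> ((\<alpha> ^^ k) x)"
proof (induction k)
  case 0
  show ?case
    using tensor_map_id[OF module_axioms module_axioms delta_closed[OF assms]]
    by (simp add: id_def)
next
  case (Suc k)
  have "tensor_map R A A A A (\<alpha> ^^ Suc k) (\<alpha> ^^ Suc k) (\<Delta> x) =
      tensor_map R A A A A \<alpha> \<alpha> (\<Delta> ((\<alpha> ^^ k) x))"
    unfolding tensor_map_funpow_Suc[OF module_axioms module_axioms alpha_linear alpha_linear
        delta_closed[OF assms]] Suc ..
  also have "\<dots> = \<Delta> ((\<alpha> ^^ Suc k) x)"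
    using delta_alpha alpha_funpow_closed[OF assms] by simp
  finally show ?case .
qed

lemma delta_funpow_linear: "\<Delta> \<circ> (\<alpha> ^^ k) \<in> lin_hom R A (tensor R A A)"
  using lin_hom_comp[OF alpha_funpow_linear delta_linear] by (simp add: comp_def)

lemma tensor_alpha_delta_funpow:
  assumes "t \<in> carrier (tensor R A A)"
  shows "tensor_map R A A A (tensor R A A) (\<alpha> ^^ Suc k) (\<Delta> \<circ> (\<alpha> ^^ k)) t =
    tensor_map R A A A (tensor R A A) \<alpha> \<Delta> (tensor_map R A A A A (\<alpha> ^^ k) (\<alpha> ^^ k) t)"
  \<comment> \<open>Dually to the product, \<alpha> is now peeled off on the left, as \<alpha> o
    \<alpha>^k, so that \<alpha>^k acts first in both tensor factors.\<close>
  unfolding funpow.simps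
  by (rule tensor_map_comp)
    (rule module_axioms tensor_square_module alpha_funpow_linear alpha_linear delta_linear assms)+

lemma tensor_delta_alpha_funpow:
  assumes "t \<in> carrier (tensor R A A)"
  shows "tensor_map R A A (tensor R A A) A (\<Delta> \<circ> (\<alpha> ^^ k)) (\<alpha> ^^ Suc k) t =
    tensor_map R A A (tensor R A A) A \<Delta> \<alpha> (tensor_map R A A A A (\<alpha> ^^ k) (\<alpha> ^^ k) t)"
  unfolding funpow.simps
  by (rule tensor_map_comp)
    (rule module_axioms tensor_square_module alpha_funpow_linear alpha_linear delta_linear assms)+

lemma tensor_alpha_delta_linear:
  "tensor_map R A A A (tensor R A A) \<alpha> \<Delta> \<in> lin_hom R (tensor R A A) (tensor R A (tensor R A A))"
  by (rule tensor_map_linear) (rule module_axioms tensor_square_module alpha_linear delta_linear)+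

lemma tensor_delta_alpha_linear:
  "tensor_map R A A (tensor R A A) A \<Delta> \<alpha> \<in> lin_hom R (tensor R A A) (tensor R (tensor R A A) A)"
  by (rule tensor_map_linear) (rule module_axioms tensor_square_module alpha_linear delta_linear)+

text \<open>Here the powers collect on the inside: the twisted Hom-coassociativity at
  \<open>x\<close> is the original one at \<alpha>^(2k) x.\<close>

lemma hom_coassociative_coalgebra_funpow:
  "hom_coassociative_coalgebra R A (\<Delta> \<circ> (\<alpha> ^^ k)) (\<alpha> ^^ Suc k)"
proof unfold_locales
  show "\<Delta> \<circ> (\<alpha> ^^ k) \<in> lin_hom R A (tensor R A A)"
    by (rule delta_funpow_linear)
  show "\<alpha> ^^ Suc k \<in> lin_hom R A A"
    by (rule alpha_funpow_linear)
  show "\<forall>x\<in>carrier A. tensor_map R A A A A (\<alpha> ^^ Suc k) (\<alpha> ^^ Suc k) ((\<Delta> \<circ> (\<alpha> ^^ k)) x) =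
      (\<Delta> \<circ> (\<alpha> ^^ k)) ((\<alpha> ^^ Suc k) x)"
  proof
    fix x assume x: "x \<in> carrier A"
    have "(\<alpha> ^^ Suc k) ((\<alpha> ^^ k) x) = (\<alpha> ^^ k) ((\<alpha> ^^ Suc k) x)"
      by (simp add: funpow_swap1)
    then show "tensor_map R A A A A (\<alpha> ^^ Suc k) (\<alpha> ^^ Suc k) ((\<Delta> \<circ> (\<alpha> ^^ k)) x) =
        (\<Delta> \<circ> (\<alpha> ^^ k)) ((\<alpha> ^^ Suc k) x)"
      using delta_alpha_funpow[OF alpha_funpow_closed[OF x], of "Suc k" k]
      by (simp only: comp_apply)
  qed
  show "\<forall>x\<in>carrier A.
      tensor_map R A A A (tensor R A A) (\<alpha> ^^ Suc k) (\<Delta> \<circ> (\<alpha> ^^ k)) ((\<Delta> \<circ> (\<alpha> ^^ k)) x) =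
      tensor_assoc R A A A
        (tensor_map R A A (tensor R A A) A (\<Delta> \<circ> (\<alpha> ^^ k)) (\<alpha> ^^ Suc k) ((\<Delta> \<circ> (\<alpha> ^^ k)) x))"
    using hom_coassoc
    \<comment> \<open>\<open>ball_cong\<close> makes the membership of \<open>x\<close> available to
      the conditional rewrites, which carry \<alpha>^k (x) \<alpha>^k through \<Delta> into its
      argument.\<close>
    by (simp only: comp_apply tensor_alpha_delta_funpow tensor_delta_alpha_funpow
        delta_alpha_funpow delta_closed alpha_funpow_closed ball_simps cong: ball_cong)
      (blast intro: alpha_funpow_closed)
qed

end

section \<open>Compatibility of the twisted product and coproduct\<close>

theorem (in epsilon_hom_bialgebra) epsilon_hom_bialgebra_funpow:
  "epsilon_hom_bialgebra R A ((\<alpha> ^^ k) \<circ> \<mu>) (\<Delta> \<circ> (\<alpha> ^^ k)) (\<alpha> ^^ Suc k)"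
proof (intro epsilon_hom_bialgebra.intro epsilon_hom_bialgebra_axioms.intro
    hom_associative_algebra_funpow hom_coassociative_coalgebra_funpow ballI)
  let ?T = "tensor R A A" and ?g = "tensor_map R A A A A (\<alpha> ^^ k) (\<alpha> ^^ k)"
  fix t assume t: "t \<in> carrier ?T"
  \<comment> \<open>The left side contains \<alpha>^k twice. One copy is pushed inwards through
    \<mu> and turns \<open>t\<close> into \<open>s\<close>; the other is pulled outwards through
    \<Delta> and becomes \<open>?g\<close>. The twisted identity at \<open>t\<close> is thus
    \<open>?g\<close> applied to the original one at \<open>s\<close>.\<close>
  define s where "s = ?g t"
  have s: "s \<in> carrier ?T"
    unfolding s_def by (rule tensor_alpha_funpow_closed[OF t])
  \<comment> \<open>\<open>p\<close> and \<open>q\<close> are taken after reassociation, so the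
    associativity maps occur unchanged in the original and the twisted identity.\<close>
  define p where "p = tensor_assoc_inv R A A A (tensor_map R A A A ?T \<alpha> \<Delta> s)"
  define q where "q = tensor_assoc R A A A (tensor_map R A A ?T A \<Delta> \<alpha> s)"
  have p: "p \<in> carrier (tensor R ?T A)"
    unfolding p_def
    by (rule lin_hom_closed[OF tensor_assoc_inv_linear lin_hom_closed[OF tensor_alpha_delta_linear s]])
      (rule module_axioms)+
  have q: "q \<in> carrier (tensor R A ?T)"
    unfolding q_def
    by (rule lin_hom_closed[OF tensor_assoc_linear lin_hom_closed[OF tensor_delta_alpha_linear s]])
      (rule module_axioms)+
  have g: "?g \<in> lin_hom R ?T ?T"
    by (rule tensor_map_linear) (rule module_axioms alpha_funpow_linear)+
  have "\<Delta> ((\<alpha> ^^ k) ((\<alpha> ^^ k) (\<mu> t))) = \<Delta> ((\<alpha> ^^ k) (\<mu> s))"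
    by (simp only: s_def alpha_funpow_mu[OF t])
  also have "\<dots> = ?g (\<Delta> (\<mu> s))"
    by (rule delta_alpha_funpow[OF lin_hom_closed[OF mu_linear s], symmetric])
  also have "\<Delta> (\<mu> s) =
      tensor_map R ?T A A A \<mu> \<alpha> p \<oplus>\<^bsub>?T\<^esub> tensor_map R A ?T A A \<alpha> \<mu> q"
    using delta_mu s by (simp only: p_def q_def)
  also have "?g \<dots> = ?g (tensor_map R ?T A A A \<mu> \<alpha> p) \<oplus>\<^bsub>?T\<^esub> ?g (tensor_map R A ?T A A \<alpha> \<mu> q)"
    using g lin_hom_closed[OF tensor_mu_alpha_linear p] lin_hom_closed[OF tensor_alpha_mu_linear q]
    by (simp add: lin_hom_def)
  finally show "(\<Delta> \<circ> (\<alpha> ^^ k)) (((\<alpha> ^^ k) \<circ> \<mu>) t) =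
      tensor_map R ?T A A A ((\<alpha> ^^ k) \<circ> \<mu>) (\<alpha> ^^ Suc k)
        (tensor_assoc_inv R A A A (tensor_map R A A A ?T (\<alpha> ^^ Suc k) (\<Delta> \<circ> (\<alpha> ^^ k)) t))
      \<oplus>\<^bsub>?T\<^esub>
      tensor_map R A ?T A A (\<alpha> ^^ Suc k) ((\<alpha> ^^ k) \<circ> \<mu>)
        (tensor_assoc R A A A (tensor_map R A A ?T A (\<Delta> \<circ> (\<alpha> ^^ k)) (\<alpha> ^^ Suc k) t))"
    \<comment> \<open>On the right side the twisted coproducts yield \<open>s\<close>, hence
      \<open>p\<close> and \<open>q\<close>, and the twisted products yield the outer
      \<open>?g\<close> in each summand.\<close>
    unfolding tensor_alpha_delta_funpow[OF t] tensor_delta_alpha_funpow[OF t]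
      s_def[symmetric] p_def[symmetric] q_def[symmetric]
      tensor_mu_alpha_funpow[OF p] tensor_alpha_mu_funpow[OF q]
    by (simp only: comp_apply)
qed

theorem theorem2p7:
  fixes R :: "('r, 'm) ring_scheme"
    and A :: "('r, 'a, 'n) module_scheme"
    and \<mu> :: "('a \<times> 'a \<Rightarrow>\<^sub>0 int) set \<Rightarrow> 'a"
    and \<Delta> :: "'a \<Rightarrow> ('a \<times> 'a \<Rightarrow>\<^sub>0 int) set"
    and \<alpha> :: "'a \<Rightarrow> 'a"
    and n :: nat
  assumes "field R"
    and char_0: "\<And>k::nat. k > 0 \<Longrightarrow> [k] \<cdot>\<^bsub>R\<^esub> \<one>\<^bsub>R\<^esub> \<noteq> \<zero>\<^bsub>R\<^esub>"
    and "epsilon_hom_bialgebra R A \<mu> \<Delta> \<alpha>"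
  shows "epsilon_hom_bialgebra R A
           ((\<alpha> ^^ (2 ^ n - 1)) \<circ> \<mu>) (\<Delta> \<circ> (\<alpha> ^^ (2 ^ n - 1))) (\<alpha> ^^ (2 ^ n))"
proof -
  \<comment> \<open>Since 2^n \<ge> 1, truncated subtraction loses nothing, and the twist by k = 2^n
    - 1 has twisting map \<alpha>^(2^n).\<close>
  have "Suc (2 ^ n - 1) = 2 ^ n" by simp
  then show ?thesis
    using epsilon_hom_bialgebra.epsilon_hom_bialgebra_funpow[OF assms(3), of "2 ^ n - 1"]
    by (simp only:)
qed

end
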